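(* Let $(X,d)$ be a u.l.f. metric space, $h\colon X\to\mathbb{R}$ a coarse map, and $\beta\in\mathbb{R}$. If $\varphi$ is a $(\sigma_h,\beta)$-KMS state on $\mathrm{C}^*_u(X)$, then $\varphi=\varphi\circ E$, where $E\colon\mathrm{C}^*_u(X)\to\ell_\infty(X)$ is the canonical conditional expectation.
   Context: A metric space is u.l.f. if for every $r>0$ the cardinalities of its balls of radius $r$ are uniformly bounded. With $(\delta_x)$ the canonical basis of $\ell_2(X)$ and $a_{x,y}=\langle a\delta_y,\delta_x\rangle$, the propagation of $a$ is $\sup\{d(x,y):a_{x,y}\neq0\}$; $\mathrm{C}^*_u[X]$ is the $^*$-algebra of finite-propagation operators and $\mathrm{C}^*_u(X)$ its norm closure. $h$ is coarse if for each $r>0$ there is $s>0$ with $d(x,y)<r\Rightarrow|h(x)-h(y)|<s$. $\sigma_h$ is the flow (strongly continuous one-parameter automorphism group) on $\mathrm{C}^*_u(X)$ given by $\sigma_{h,t}(a)=e^{it\bar h}ae^{-it\bar h}$, where $e^{it\bar h}\delta_x=e^{ith(x)}\delta_x$. An element $b$ is analytic if $t\mapsto\sigma_{h,t}(b)$ extends to an entire map $z\mapsto\sigma_{h,z}(b)$. A state $\varphi$ is a $(\sigma_h,\beta)$-KMS state if $\varphi(a\sigma_{h,i\beta}(b))=\varphi(ba)$ for all $a\in\mathrm{C}^*_u(X)$ and all analytic $b$. $\ell_\infty(X)$ is identified with the diagonal operators on $\ell_2(X)$, and $E$ sends $a$ to the diagonal operator with entries $a_{x,x}$. *)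

theory Defs
  imports "HOL-Analysis.Analysis"
begin

text \<open>Operators on l2(X) are represented by their matrices a x y = <a delta_y, delta_x>.\<close>

definition ulf :: "'a::metric_space itself \<Rightarrow> bool" where
  "ulf _ \<longleftrightarrow> (\<forall>r>0. \<exists>N::nat. \<forall>x::'a. finite (ball x r) \<and> card (ball x r) \<le> N)"

definition coarse_fun :: "('a::metric_space \<Rightarrow> real) \<Rightarrow> bool" where
  "coarse_fun h \<longleftrightarrow> (\<forall>r>0. \<exists>s>0. \<forall>x y. dist x y < r \<longrightarrow> \<bar>h x - h y\<bar> < s)"

definition l2 :: "('a \<Rightarrow> complex) set" where
  "l2 = {f. (\<lambda>x. (cmod (f x))\<^sup>2) summable_on UNIV}"

definition l2norm :: "('a \<Rightarrow> complex) \<Rightarrow> real" where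
  "l2norm f = sqrt (infsum (\<lambda>x. (cmod (f x))\<^sup>2) UNIV)"

definition mapply :: "('a \<Rightarrow> 'a \<Rightarrow> complex) \<Rightarrow> ('a \<Rightarrow> complex) \<Rightarrow> ('a \<Rightarrow> complex)" where
  "mapply a f = (\<lambda>x. infsum (\<lambda>y. a x y * f y) UNIV)"

definition bdd_op :: "('a \<Rightarrow> 'a \<Rightarrow> complex) \<Rightarrow> bool" where
  "bdd_op a \<longleftrightarrow> (\<exists>C. \<forall>f\<in>l2. (\<forall>x. (\<lambda>y. a x y * f y) summable_on UNIV)
      \<and> mapply a f \<in> l2 \<and> l2norm (mapply a f) \<le> C * l2norm f)"

definition opnorm :: "('a \<Rightarrow> 'a \<Rightarrow> complex) \<Rightarrow> real" where
  "opnorm a = Sup {l2norm (mapply a f) | f. f \<in> l2 \<and> l2norm f \<le> 1}"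

definition mmult :: "('a \<Rightarrow> 'a \<Rightarrow> complex) \<Rightarrow> ('a \<Rightarrow> 'a \<Rightarrow> complex) \<Rightarrow> ('a \<Rightarrow> 'a \<Rightarrow> complex)" where
  "mmult a b = (\<lambda>x z. infsum (\<lambda>y. a x y * b y z) UNIV)"

definition madj :: "('a \<Rightarrow> 'a \<Rightarrow> complex) \<Rightarrow> ('a \<Rightarrow> 'a \<Rightarrow> complex)" where
  "madj a = (\<lambda>x y. cnj (a y x))"

definition mid :: "'a \<Rightarrow> 'a \<Rightarrow> complex" where
  "mid = (\<lambda>x y. if x = y then 1 else 0)"

definition finite_prop :: "('a::metric_space \<Rightarrow> 'a \<Rightarrow> complex) \<Rightarrow> bool" where
  "finite_prop a \<longleftrightarrow> (\<exists>R. \<forall>x y. a x y \<noteq> 0 \<longrightarrow> dist x y \<le> R)"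

definition roe_alg :: "('a::metric_space \<Rightarrow> 'a \<Rightarrow> complex) set" where
  "roe_alg = {a. bdd_op a \<and> finite_prop a}"

definition uroe :: "('a::metric_space \<Rightarrow> 'a \<Rightarrow> complex) set" where
  "uroe = {a. bdd_op a \<and> (\<forall>e>0. \<exists>b\<in>roe_alg. opnorm (\<lambda>x y. a x y - b x y) < e)}"

definition is_state :: "(('a::metric_space \<Rightarrow> 'a \<Rightarrow> complex) \<Rightarrow> complex) \<Rightarrow> bool" where
  "is_state \<phi> \<longleftrightarrow>
     (\<forall>a\<in>uroe. \<forall>b\<in>uroe. \<forall>c. \<phi> (\<lambda>x y. a x y + c * b x y) = \<phi> a + c * \<phi> b)
   \<and> (\<forall>a\<in>uroe. Im (\<phi> (mmult (madj a) a)) = 0 \<and> Re (\<phi> (mmult (madj a) a)) \<ge> 0)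
   \<and> \<phi> mid = 1"

definition flow :: "('a \<Rightarrow> real) \<Rightarrow> real \<Rightarrow> ('a \<Rightarrow> 'a \<Rightarrow> complex) \<Rightarrow> ('a \<Rightarrow> 'a \<Rightarrow> complex)" where
  "flow h t a = (\<lambda>x y. exp (\<i> * of_real t * of_real (h x)) * a x y * exp (- \<i> * of_real t * of_real (h y)))"

definition entire_ext :: "('a::metric_space \<Rightarrow> real) \<Rightarrow> ('a \<Rightarrow> 'a \<Rightarrow> complex)
     \<Rightarrow> (complex \<Rightarrow> 'a \<Rightarrow> 'a \<Rightarrow> complex) \<Rightarrow> bool" where
  "entire_ext h b F \<longleftrightarrow>
     (\<forall>z. F z \<in> uroe) \<and> (\<forall>t::real. F (of_real t) = flow h t b)
   \<and> (\<forall>z. \<exists>D. bdd_op D \<and>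
        ((\<lambda>w. opnorm (\<lambda>x y. (F (z + w) x y - F z x y) / w - D x y)) \<longlongrightarrow> 0) (at 0))"

definition analytic_elem :: "('a::metric_space \<Rightarrow> real) \<Rightarrow> ('a \<Rightarrow> 'a \<Rightarrow> complex) \<Rightarrow> bool" where
  "analytic_elem h b \<longleftrightarrow> b \<in> uroe \<and> (\<exists>F. entire_ext h b F)"

definition is_KMS :: "('a::metric_space \<Rightarrow> real) \<Rightarrow> real \<Rightarrow> (('a \<Rightarrow> 'a \<Rightarrow> complex) \<Rightarrow> complex) \<Rightarrow> bool" where
  "is_KMS h \<beta> \<phi> \<longleftrightarrow> is_state \<phi> \<and>
     (\<forall>a\<in>uroe. \<forall>b F. b \<in> uroe \<longrightarrow> entire_ext h b F \<longrightarrow>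
        \<phi> (mmult a (F (\<i> * of_real \<beta>))) = \<phi> (mmult b a))"

definition cond_exp :: "('a \<Rightarrow> 'a \<Rightarrow> complex) \<Rightarrow> ('a \<Rightarrow> 'a \<Rightarrow> complex)" where
  "cond_exp a = (\<lambda>x y. if x = y then a x x else 0)"

end

theory Submission
  imports Defs
begin

text \<open>A diagonal projection \<open>p\<close> is fixed by the flow, so the KMS condition gives \<open>\<phi>(a p) = \<phi>(p a)\<close>. Given \<open>R\<close>,
  uniform local finiteness yields a colouring of \<open>X\<close> by finitely many colours in which distinct points
  of equal colour are more than \<open>R\<close> apart; compressing an operator of propagation at most \<open>R\<close> to one
  colour leaves only its diagonal, so \<open>\<phi> = \<phi> \<circ> E\<close> on operators of finite propagation. The general
  case follows because a state is norm bounded: \<open>1 - x\<close> is a square \<open>d\<^sup>* d\<close> for self-adjoint \<open>x\<close> of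
  norm at most \<open>1/2\<close>, whence \<open>\<phi>(x) \<le> 1\<close>.\<close>

section \<open>Operator bounds by finite sections\<close>

text \<open>The bilinear form of the matrix is tested on finitely supported vectors only, so no
  convergence question enters. \<open>C\<close> is any admissible bound, not necessarily the
  norm.\<close>

definition op_bound :: "real \<Rightarrow> ('a \<Rightarrow> 'a \<Rightarrow> complex) \<Rightarrow> bool" where
  "op_bound C a \<longleftrightarrow> 0 \<le> C \<and> (\<forall>F G f g. finite F \<longrightarrow> finite G \<longrightarrow>
     cmod (\<Sum>x\<in>F. \<Sum>y\<in>G. g x * a x y * f y)
       \<le> C * L2_set (\<lambda>x. cmod (g x)) F * L2_set (\<lambda>y. cmod (f y)) G)"

lemma op_bound_nonneg: "op_bound C a \<Longrightarrow> 0 \<le> C"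
  by (simp add: op_bound_def)

lemma op_boundD:
  "op_bound C a \<Longrightarrow> finite F \<Longrightarrow> finite G \<Longrightarrow>
     cmod (\<Sum>x\<in>F. \<Sum>y\<in>G. g x * a x y * f y)
       \<le> C * L2_set (\<lambda>x. cmod (g x)) F * L2_set (\<lambda>y. cmod (f y)) G"
  by (simp add: op_bound_def)

lemma cmod_sum_mult_le_L2:
  fixes u v :: "'a \<Rightarrow> complex"
  shows "cmod (\<Sum>x\<in>F. u x * v x) \<le> L2_set (\<lambda>x. cmod (u x)) F * L2_set (\<lambda>x. cmod (v x)) F"
proof -
  have "cmod (\<Sum>x\<in>F. u x * v x) \<le> (\<Sum>x\<in>F. \<bar>cmod (u x)\<bar> * \<bar>cmod (v x)\<bar>)"
    by (rule order_trans[OF norm_sum]) (simp add: norm_mult)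
  also have "\<dots> \<le> L2_set (\<lambda>x. cmod (u x)) F * L2_set (\<lambda>x. cmod (v x)) F"
    by (rule L2_set_mult_ineq)
  finally show ?thesis .
qed

text \<open>Testing the form against the conjugate of the image vector \<open>v\<close> gives
  \<open>L * L \<le> C * L * \<parallel>f\<parallel>\<close>, with \<open>L\<close> the length of
  \<open>v\<close> on \<open>F\<close>; then \<open>L\<close> is cancelled.\<close>

lemma op_bound_L2:
  assumes "op_bound C a" "finite F" "finite G"
  shows "L2_set (\<lambda>x. cmod (\<Sum>y\<in>G. a x y * f y)) F \<le> C * L2_set (\<lambda>y. cmod (f y)) G"
proof -
  define v where "v = (\<lambda>x. \<Sum>y\<in>G. a x y * f y)"
  define L where "L = L2_set (\<lambda>x. cmod (v x)) F"
  have L0: "0 \<le> L" by (simp add: L_def L2_set_nonneg)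
  have "(\<Sum>x\<in>F. \<Sum>y\<in>G. cnj (v x) * a x y * f y) = (\<Sum>x\<in>F. cnj (v x) * v x)"
    by (simp add: v_def sum_distrib_left mult.assoc)
  also have "\<dots> = (\<Sum>x\<in>F. of_real ((cmod (v x))\<^sup>2))"
    by (intro sum.cong refl) (metis complex_norm_square mult.commute)
  also have "\<dots> = of_real (\<Sum>x\<in>F. (cmod (v x))\<^sup>2)"
    by simp
  also have "\<dots> = of_real (L\<^sup>2)"
    by (simp add: L_def L2_set_def sum_nonneg)
  finally have "cmod (of_real (L\<^sup>2)) \<le> C * L * L2_set (\<lambda>y. cmod (f y)) G"
    using op_boundD[OF assms, of "\<lambda>x. cnj (v x)" f] by (simp add: L_def)
  then have "L * L \<le> L * (C * L2_set (\<lambda>y. cmod (f y)) G)"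
    by (simp add: power2_eq_square mult_ac norm_mult)
  then have "L \<le> C * L2_set (\<lambda>y. cmod (f y)) G"
    using L0 op_bound_nonneg[OF assms(1)]
    by (cases "L = 0") (auto simp: L2_set_nonneg)
  then show ?thesis by (simp add: L_def v_def)
qed

text \<open>Converse of \<open>op_bound_L2\<close>, by Cauchy-Schwarz in the row index.\<close>

lemma op_boundI:
  assumes "0 \<le> C"
    and "\<And>F G f. finite F \<Longrightarrow> finite G \<Longrightarrow>
      L2_set (\<lambda>x. cmod (\<Sum>y\<in>G. a x y * f y)) F \<le> C * L2_set (\<lambda>y. cmod (f y)) G"
  shows "op_bound C a"
  unfolding op_bound_def
proof (intro conjI allI impI)
  fix F G :: "'a set" and f g :: "'a \<Rightarrow> complex"
  assume FG: "finite F" "finite G"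
  have "cmod (\<Sum>x\<in>F. \<Sum>y\<in>G. g x * a x y * f y) = cmod (\<Sum>x\<in>F. g x * (\<Sum>y\<in>G. a x y * f y))"
    by (simp add: sum_distrib_left mult.assoc)
  also have "\<dots> \<le> L2_set (\<lambda>x. cmod (g x)) F * L2_set (\<lambda>x. cmod (\<Sum>y\<in>G. a x y * f y)) F"
    by (rule cmod_sum_mult_le_L2)
  also have "\<dots> \<le> L2_set (\<lambda>x. cmod (g x)) F * (C * L2_set (\<lambda>y. cmod (f y)) G)"
    by (intro mult_left_mono assms FG L2_set_nonneg)
  finally show "cmod (\<Sum>x\<in>F. \<Sum>y\<in>G. g x * a x y * f y)
       \<le> C * L2_set (\<lambda>x. cmod (g x)) F * L2_set (\<lambda>y. cmod (f y)) G"
    by (simp add: mult_ac)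
qed (rule assms)

lemma op_bound_mono: "op_bound C a \<Longrightarrow> C \<le> D \<Longrightarrow> op_bound D a"
  unfolding op_bound_def
  by (meson L2_set_nonneg mult_right_mono order_trans)

lemma op_bound_add:
  assumes "op_bound C a" "op_bound D b"
  shows "op_bound (C + D) (\<lambda>x y. a x y + b x y)"
  unfolding op_bound_def
proof (intro conjI allI impI)
  fix F G :: "'a set" and f g :: "'a \<Rightarrow> complex"
  assume FG: "finite F" "finite G"
  show "cmod (\<Sum>x\<in>F. \<Sum>y\<in>G. g x * (a x y + b x y) * f y)
       \<le> (C + D) * L2_set (\<lambda>x. cmod (g x)) F * L2_set (\<lambda>y. cmod (f y)) G"
    using norm_triangle_mono[OF op_boundD[OF assms(1) FG, of g f] op_boundD[OF assms(2) FG, of g f]]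
    by (simp add: sum.distrib algebra_simps)
qed (simp add: assms[THEN op_bound_nonneg])

lemma op_bound_scale:
  assumes "op_bound C a"
  shows "op_bound (cmod c * C) (\<lambda>x y. c * a x y)"
  unfolding op_bound_def
proof (intro conjI allI impI)
  fix F G :: "'a set" and f g :: "'a \<Rightarrow> complex"
  assume FG: "finite F" "finite G"
  have "(\<Sum>x\<in>F. \<Sum>y\<in>G. g x * (c * a x y) * f y) = c * (\<Sum>x\<in>F. \<Sum>y\<in>G. g x * a x y * f y)"
    by (simp add: sum_distrib_left mult_ac)
  then show "cmod (\<Sum>x\<in>F. \<Sum>y\<in>G. g x * (c * a x y) * f y)
       \<le> (cmod c * C) * L2_set (\<lambda>x. cmod (g x)) F * L2_set (\<lambda>y. cmod (f y)) G"
    using mult_left_mono[OF op_boundD[OF assms FG, of g f], of "cmod c"]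
    by (simp add: norm_mult mult.assoc)
qed (use assms op_bound_nonneg in force)

lemma op_bound_diff:
  assumes "op_bound C a" "op_bound D b"
  shows "op_bound (C + D) (\<lambda>x y. a x y - b x y)"
  using op_bound_add[OF assms(1) op_bound_scale[OF assms(2), of "-1"]] by simp

text \<open>Swapping the two finite sums and conjugating turns the form of \<open>madj a\<close> at
  \<open>g, f\<close> into that of \<open>a\<close> at the conjugates of \<open>f, g\<close>; the
  modulus does not change.\<close>

lemma op_bound_madj:
  assumes "op_bound C a"
  shows "op_bound C (madj a)"
  unfolding op_bound_def
proof (intro conjI allI impI)
  fix F G :: "'a set" and f g :: "'a \<Rightarrow> complex"
  assume FG: "finite F" "finite G"
  have "(\<Sum>x\<in>F. \<Sum>y\<in>G. g x * madj a x y * f y)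
     = cnj (\<Sum>y\<in>G. \<Sum>x\<in>F. cnj (f y) * a y x * cnj (g x))"
    by (subst sum.swap) (simp add: madj_def mult_ac)
  then show "cmod (\<Sum>x\<in>F. \<Sum>y\<in>G. g x * madj a x y * f y)
       \<le> C * L2_set (\<lambda>x. cmod (g x)) F * L2_set (\<lambda>y. cmod (f y)) G"
    using op_boundD[OF assms FG(2,1), of "\<lambda>y. cnj (f y)" "\<lambda>x. cnj (g x)"]
    by (simp add: mult_ac del: cnj_sum)
qed (use assms op_bound_nonneg in force)

lemma op_bound_entry: "op_bound C a \<Longrightarrow> cmod (a x y) \<le> C"
  using op_boundD[of C a "{x}" "{y}" "\<lambda>_. 1" "\<lambda>_. 1"] by simp

text \<open>Each test involves finitely many entries, so entrywise convergence suffices. The limit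
  of the square-root iteration inherits its bounds this way.\<close>

lemma op_bound_limit:
  assumes "\<And>n. op_bound C (A n)" "\<And>x y. (\<lambda>n. A n x y) \<longlonglongrightarrow> a x y"
  shows "op_bound C a"
  unfolding op_bound_def
proof (intro conjI allI impI)
  fix F G :: "'a set" and f g :: "'a \<Rightarrow> complex"
  assume FG: "finite F" "finite G"
  have "(\<lambda>n. cmod (\<Sum>x\<in>F. \<Sum>y\<in>G. g x * A n x y * f y))
     \<longlonglongrightarrow> cmod (\<Sum>x\<in>F. \<Sum>y\<in>G. g x * a x y * f y)"
    by (intro tendsto_intros assms)
  then show "cmod (\<Sum>x\<in>F. \<Sum>y\<in>G. g x * a x y * f y)
       \<le> C * L2_set (\<lambda>x. cmod (g x)) F * L2_set (\<lambda>y. cmod (f y)) G"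
    by (rule LIMSEQ_le_const2) (use op_boundD[OF assms(1) FG] in blast)
qed (use assms(1) op_bound_nonneg in blast)

lemma op_bound_diag:
  assumes "0 \<le> C" "\<And>x. cmod (d x) \<le> C"
  shows "op_bound C (\<lambda>x y. if x = y then d x else 0)"
proof (rule op_boundI)
  fix F G :: "'a set" and f :: "'a \<Rightarrow> complex"
  assume FG: "finite F" "finite G"
  have "L2_set (\<lambda>x. cmod (\<Sum>y\<in>G. (if x = y then d x else 0) * f y)) F
      = L2_set (\<lambda>x. if x \<in> G then cmod (d x * f x) else 0) F"
    by (rule L2_set_cong)
       (auto simp: if_distrib[where f="\<lambda>u. u * _"] FG cong: if_cong)
  also have "\<dots> = L2_set (\<lambda>x. cmod (d x * f x)) (F \<inter> G)"
    unfolding L2_set_def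
    by (simp add: if_distrib[where f="\<lambda>u. u\<^sup>2"] sum.inter_restrict[OF FG(1)] cong: if_cong)
  also have "\<dots> \<le> L2_set (\<lambda>x. C * cmod (f x)) (F \<inter> G)"
    by (rule L2_set_mono) (auto simp: norm_mult intro: mult_right_mono assms)
  also have "\<dots> \<le> L2_set (\<lambda>x. C * cmod (f x)) G"
    unfolding L2_set_def by (intro real_sqrt_le_mono sum_mono2 FG) auto
  also have "\<dots> = C * L2_set (\<lambda>y. cmod (f y)) G"
    by (rule L2_set_right_distrib[symmetric, OF assms(1)])
  finally show "L2_set (\<lambda>x. cmod (\<Sum>y\<in>G. (if x = y then d x else 0) * f y)) F
      \<le> C * L2_set (\<lambda>y. cmod (f y)) G" .
qed (rule assms)

lemma op_bound_zero: "op_bound 0 (\<lambda>x y. 0)"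
  by (simp add: op_bound_def)

lemma op_bound_mid: "op_bound 1 mid"
  unfolding mid_def by (rule op_bound_diag) auto

lemma op_bound_column:
  assumes "op_bound C a" "finite F"
  shows "L2_set (\<lambda>x. cmod (a x y)) F \<le> C"
  using op_bound_L2[OF assms, of "{y}" "\<lambda>_. 1"] by simp

lemma op_bound_row:
  assumes "op_bound C a" "finite G"
  shows "L2_set (\<lambda>y. cmod (a x y)) G \<le> C"
  using op_bound_column[OF op_bound_madj[OF assms(1)] assms(2), of x] by (simp add: madj_def)

lemma op_bound_L2_left:
  assumes "op_bound C a" "finite F" "finite G"
  shows "L2_set (\<lambda>y. cmod (\<Sum>x\<in>F. g x * a x y)) G \<le> C * L2_set (\<lambda>x. cmod (g x)) F"
proof -
  have "cmod (\<Sum>x\<in>F. madj a y x * cnj (g x)) = cmod (\<Sum>x\<in>F. g x * a x y)" for y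
  proof -
    have "(\<Sum>x\<in>F. madj a y x * cnj (g x)) = cnj (\<Sum>x\<in>F. g x * a x y)"
      by (simp add: madj_def mult.commute)
    then show ?thesis by (metis complex_mod_cnj)
  qed
  then show ?thesis
    using op_bound_L2[OF op_bound_madj[OF assms(1)] assms(3,2), of "\<lambda>x. cnj (g x)"] by simp
qed

section \<open>Products of bounded matrices\<close>

lemma summable_on_mult_L2:
  fixes u v :: "'a \<Rightarrow> complex"
  assumes "\<And>F. finite F \<Longrightarrow> L2_set (\<lambda>y. cmod (u y)) F \<le> C"
    and "\<And>F. finite F \<Longrightarrow> L2_set (\<lambda>y. cmod (v y)) F \<le> D"
  shows "(\<lambda>y. u y * v y) summable_on UNIV"
proof (rule abs_summable_summable, rule nonneg_bdd_above_summable_on)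
  have "0 \<le> C" using assms(1)[of "{}"] by simp
  have "sum (\<lambda>y. cmod (u y * v y)) F \<le> C * D" if "finite F" for F
  proof -
    have "sum (\<lambda>y. cmod (u y * v y)) F \<le> L2_set (\<lambda>y. cmod (u y)) F * L2_set (\<lambda>y. cmod (v y)) F"
      using L2_set_mult_ineq[of "\<lambda>y. cmod (u y)" "\<lambda>y. cmod (v y)" F] by (simp add: norm_mult)
    also have "\<dots> \<le> C * D"
      by (intro mult_mono assms that L2_set_nonneg \<open>0 \<le> C\<close>)
    finally show ?thesis .
  qed
  then show "bdd_above (sum (\<lambda>y. cmod (u y * v y)) ` {F. F \<subseteq> UNIV \<and> finite F})"
    by (auto simp: bdd_above_def)
qed auto

lemma mmult_summable:
  assumes "op_bound C a" "op_bound D b"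
  shows "(\<lambda>y. a x y * b y z) summable_on UNIV"
  by (rule summable_on_mult_L2[OF op_bound_row[OF assms(1)] op_bound_column[OF assms(2)]])

lemma norm_infsum_le_finite_sums:
  fixes f :: "'a \<Rightarrow> 'b::banach"
  assumes "f summable_on UNIV" "\<And>F. finite F \<Longrightarrow> norm (sum f F) \<le> K"
  shows "norm (infsum f UNIV) \<le> K"
proof -
  have "(sum f \<longlongrightarrow> infsum f UNIV) (finite_subsets_at_top UNIV)"
    using has_sum_infsum[OF assms(1)] by (simp add: has_sum_def)
  then have "((\<lambda>F. norm (sum f F)) \<longlongrightarrow> norm (infsum f UNIV)) (finite_subsets_at_top UNIV)"
    by (rule tendsto_norm)
  then show ?thesis
    by (rule tendsto_upperbound)
       (auto intro!: eventually_finite_subsets_at_top_weakI assms)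
qed

lemma has_sum_finite_sum:
  fixes f :: "'i \<Rightarrow> 'a \<Rightarrow> 'b::topological_comm_monoid_add"
  assumes "finite I" "\<And>i. i \<in> I \<Longrightarrow> (f i has_sum S i) A"
  shows "((\<lambda>x. \<Sum>i\<in>I. f i x) has_sum (\<Sum>i\<in>I. S i)) A"
  using assms by (induction I) (auto intro: has_sum_add)

text \<open>For each intermediate index \<open>y\<close> the double sum factors into a combination
  of rows of \<open>a\<close> times a combination of columns of \<open>b\<close>. Cauchy-Schwarz in
  \<open>y\<close> bounds every finite partial sum of these products, hence the infinite
  one.\<close>

lemma op_bound_mmult:
  assumes "op_bound C a" "op_bound D b"
  shows "op_bound (C * D) (mmult a b)"
  unfolding op_bound_def
proof (intro conjI allI impI)
  show "0 \<le> C * D" using assms[THEN op_bound_nonneg] by simp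
  fix F G :: "'a set" and f g :: "'a \<Rightarrow> complex"
  assume FG: "finite F" "finite G"
  define H where "H = (\<lambda>y. (\<Sum>x\<in>F. g x * a x y) * (\<Sum>z\<in>G. b y z * f z))"
  have "((\<lambda>y. \<Sum>x\<in>F. \<Sum>z\<in>G. g x * (a x y * b y z) * f z) has_sum
      (\<Sum>x\<in>F. \<Sum>z\<in>G. g x * mmult a b x z * f z)) UNIV"
    unfolding mmult_def
    by (intro has_sum_finite_sum FG has_sum_cmult_left has_sum_cmult_right has_sum_infsum
        mmult_summable[OF assms])
  moreover have "(\<lambda>y. \<Sum>x\<in>F. \<Sum>z\<in>G. g x * (a x y * b y z) * f z) = H"
    unfolding H_def sum_product by (simp add: mult_ac)
  ultimately have H: "(H has_sum (\<Sum>x\<in>F. \<Sum>z\<in>G. g x * mmult a b x z * f z)) UNIV"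
    by simp
  have "cmod (infsum H UNIV) \<le> C * D * L2_set (\<lambda>x. cmod (g x)) F * L2_set (\<lambda>y. cmod (f y)) G"
  proof (rule norm_infsum_le_finite_sums)
    show "H summable_on UNIV" using H by (rule has_sum_imp_summable)
    fix T :: "'a set" assume T: "finite T"
    have "cmod (sum H T) \<le> L2_set (\<lambda>y. cmod (\<Sum>x\<in>F. g x * a x y)) T
        * L2_set (\<lambda>y. cmod (\<Sum>z\<in>G. b y z * f z)) T"
      unfolding H_def by (rule cmod_sum_mult_le_L2)
    also have "\<dots> \<le> (C * L2_set (\<lambda>x. cmod (g x)) F) * (D * L2_set (\<lambda>y. cmod (f y)) G)"
      using assms op_bound_nonneg[OF assms(1)]
      by (intro mult_mono op_bound_L2 op_bound_L2_left FG T mult_nonneg_nonneg L2_set_nonneg) auto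
    finally show "cmod (sum H T)
        \<le> C * D * L2_set (\<lambda>x. cmod (g x)) F * L2_set (\<lambda>y. cmod (f y)) G"
      by (simp add: mult_ac)
  qed
  then show "cmod (\<Sum>x\<in>F. \<Sum>z\<in>G. g x * mmult a b x z * f z)
      \<le> C * D * L2_set (\<lambda>x. cmod (g x)) F * L2_set (\<lambda>y. cmod (f y)) G"
    using infsumI[OF H] by simp
qed

section \<open>Comparison with the operator norm\<close>

lemma l2_finite_support:
  assumes "finite G"
  shows "(\<lambda>y. if y \<in> G then f y else 0) \<in> l2"
    and "l2norm (\<lambda>y. if y \<in> G then f y else 0) = L2_set (\<lambda>y. cmod (f y)) G"
proof -
  have *: "((\<lambda>y. (cmod (if y \<in> G then f y else 0))\<^sup>2) has_sum (\<Sum>y\<in>G. (cmod (f y))\<^sup>2)) UNIV"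
    by (rule has_sum_finite_neutralI[OF assms]) auto
  show "(\<lambda>y. if y \<in> G then f y else 0) \<in> l2"
    using * by (auto simp: l2_def summable_on_def)
  show "l2norm (\<lambda>y. if y \<in> G then f y else 0) = L2_set (\<lambda>y. cmod (f y)) G"
    unfolding l2norm_def L2_set_def using infsumI[OF *] by simp
qed

lemma L2_set_le_l2norm:
  assumes "f \<in> l2" "finite F"
  shows "L2_set (\<lambda>x. cmod (f x)) F \<le> l2norm f"
  unfolding L2_set_def l2norm_def
  using assms by (intro real_sqrt_le_mono finite_sum_le_infsum) (auto simp: l2_def)

lemma l2I:
  assumes "\<And>F. finite F \<Longrightarrow> L2_set (\<lambda>x. cmod (f x)) F \<le> K"
  shows "f \<in> l2" "l2norm f \<le> K"
proof -
  have K: "0 \<le> K" using assms[of "{}"] by simp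
  have *: "(\<Sum>x\<in>F. (cmod (f x))\<^sup>2) \<le> K\<^sup>2" if "finite F" for F
    using assms[OF that] by (simp add: L2_set_def sqrt_le_D)
  have s: "(\<lambda>x. (cmod (f x))\<^sup>2) summable_on UNIV"
    by (rule nonneg_bdd_above_summable_on) (auto simp: bdd_above_def intro!: exI[of _ "K\<^sup>2"] *)
  then show "f \<in> l2" by (simp add: l2_def)
  have "infsum (\<lambda>x. (cmod (f x))\<^sup>2) UNIV \<le> K\<^sup>2"
    by (rule infsum_le_finite_sums[OF s]) (rule *)
  then show "l2norm f \<le> K"
    unfolding l2norm_def by (rule real_le_lsqrt[OF K])
qed

text \<open>Rows of \<open>a\<close> are square summable, so they pair with \<open>f\<close>. On a
  finite set \<open>F\<close> of rows the estimate passes to the limit over finite \<open>G\<close>,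
  and \<open>l2I\<close> then removes the restriction to \<open>F\<close>.\<close>

lemma op_bound_mapply:
  assumes a: "op_bound C a" and f: "f \<in> l2"
  shows "(\<lambda>y. a x y * f y) summable_on UNIV"
    and "mapply a f \<in> l2" and "l2norm (mapply a f) \<le> C * l2norm f"
proof -
  have s: "(\<lambda>y. a x y * f y) summable_on UNIV" for x
    by (rule summable_on_mult_L2[OF op_bound_row[OF a] L2_set_le_l2norm[OF f]])
  then show "(\<lambda>y. a x y * f y) summable_on UNIV" .
  have *: "L2_set (\<lambda>x. cmod (mapply a f x)) F \<le> C * l2norm f" if F: "finite F" for F
  proof -
    have "((\<lambda>G. L2_set (\<lambda>x. cmod (\<Sum>y\<in>G. a x y * f y)) F)
        \<longlongrightarrow> L2_set (\<lambda>x. cmod (mapply a f x)) F) (finite_subsets_at_top UNIV)"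
      unfolding L2_set_def mapply_def using has_sum_infsum[OF s]
      by (intro tendsto_intros) (simp add: has_sum_def)
    then show ?thesis
    proof (rule tendsto_upperbound)
      have "L2_set (\<lambda>x. cmod (\<Sum>y\<in>G. a x y * f y)) F \<le> C * l2norm f" if "finite G" for G
        by (rule order_trans[OF op_bound_L2[OF a F that]])
           (intro mult_left_mono L2_set_le_l2norm f that op_bound_nonneg[OF a])
      then show "\<forall>\<^sub>F G in finite_subsets_at_top UNIV.
          L2_set (\<lambda>x. cmod (\<Sum>y\<in>G. a x y * f y)) F \<le> C * l2norm f"
        by (intro eventually_finite_subsets_at_top_weakI)
    qed auto
  qed
  show "mapply a f \<in> l2" "l2norm (mapply a f) \<le> C * l2norm f"
    by (rule l2I[OF *], assumption)+
qed

lemma op_bound_imp_bdd_op: "op_bound C a \<Longrightarrow> bdd_op a"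
  unfolding bdd_op_def by (blast intro: op_bound_mapply)

lemma opnorm_le:
  assumes "op_bound C a"
  shows "opnorm a \<le> C"
  unfolding opnorm_def
proof (rule cSup_least)
  have "(\<lambda>_. 0) \<in> l2" "l2norm (\<lambda>_. 0) \<le> 1"
    by (simp_all add: l2_def l2norm_def)
  then show "{l2norm (mapply a f) |f. f \<in> l2 \<and> l2norm f \<le> 1} \<noteq> {}" by blast
next
  fix r assume "r \<in> {l2norm (mapply a f) |f. f \<in> l2 \<and> l2norm f \<le> 1}"
  then obtain f where f: "f \<in> l2" "l2norm f \<le> 1" "r = l2norm (mapply a f)" by blast
  have "r \<le> C * l2norm f" using op_bound_mapply(3)[OF assms f(1)] f(3) by simp
  also have "\<dots> \<le> C * 1" using f(2) op_bound_nonneg[OF assms] by (intro mult_left_mono)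
  finally show "r \<le> C" by simp
qed

text \<open>On a finitely supported vector \<open>mapply\<close> is a finite sum, so estimates in
  \<open>l2\<close> translate directly into finite sections.\<close>

lemma op_bound_of_finite_support:
  assumes "0 \<le> C"
    and "\<And>f G. finite G \<Longrightarrow> mapply a (\<lambda>y. if y \<in> G then f y else 0) \<in> l2 \<and>
      l2norm (mapply a (\<lambda>y. if y \<in> G then f y else 0)) \<le> C * L2_set (\<lambda>y. cmod (f y)) G"
  shows "op_bound C a"
proof (rule op_boundI)
  fix F G :: "'a set" and f :: "'a \<Rightarrow> complex"
  assume FG: "finite F" "finite G"
  define k where "k = (\<lambda>y. if y \<in> G then f y else 0)"
  have "mapply a k x = (\<Sum>y\<in>G. a x y * f y)" for x
    unfolding mapply_def k_def
    by (rule infsumI, rule has_sum_finite_neutralI[OF FG(2)]) auto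
  then show "L2_set (\<lambda>x. cmod (\<Sum>y\<in>G. a x y * f y)) F \<le> C * L2_set (\<lambda>y. cmod (f y)) G"
    using L2_set_le_l2norm[of "mapply a k" F] assms(2)[OF FG(2), of f] FG(1)
    by (simp add: k_def)
qed (rule assms)

lemma bdd_op_iff_op_bound: "bdd_op a \<longleftrightarrow> (\<exists>C. op_bound C a)"
proof
  assume "bdd_op a"
  then obtain C where C: "\<And>f. f \<in> l2 \<Longrightarrow> mapply a f \<in> l2 \<and> l2norm (mapply a f) \<le> C * l2norm f"
    unfolding bdd_op_def by blast
  \<comment> \<open>The constant in \<open>bdd_op\<close> may be negative a priori, whereas
    \<open>op_bound\<close> asks for a nonnegative one.\<close>
  have "op_bound (max C 0) a"
  proof (rule op_bound_of_finite_support)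
    fix f :: "'a \<Rightarrow> complex" and G :: "'a set" assume G: "finite G"
    define k where "k = (\<lambda>y. if y \<in> G then f y else 0)"
    have k: "k \<in> l2" "l2norm k = L2_set (\<lambda>y. cmod (f y)) G"
      using l2_finite_support[OF G] by (auto simp: k_def)
    have "C * l2norm k \<le> max C 0 * l2norm k"
      by (intro mult_right_mono) (auto simp: k L2_set_nonneg)
    then show "mapply a k \<in> l2 \<and> l2norm (mapply a k) \<le> max C 0 * L2_set (\<lambda>y. cmod (f y)) G"
      using C[OF k(1)] k(2) by simp
  qed simp
  then show "\<exists>C. op_bound C a" ..
qed (use op_bound_imp_bdd_op in blast)

text \<open>The given bound \<open>C\<close> makes the supremum finite; homogeneity extends its
  estimate from the unit ball to all finitely supported vectors. With \<open>opnorm_le\<close>, the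
  operator norm is thus the least admissible constant.\<close>

lemma op_bound_opnorm:
  assumes "op_bound C a"
  shows "op_bound (opnorm a) a"
proof -
  have bdd: "bdd_above {l2norm (mapply a f) |f. f \<in> l2 \<and> l2norm f \<le> 1}"
  proof (rule bdd_aboveI)
    fix r assume "r \<in> {l2norm (mapply a f) |f. f \<in> l2 \<and> l2norm f \<le> 1}"
    then obtain f where f: "f \<in> l2" "l2norm f \<le> 1" "r = l2norm (mapply a f)" by blast
    have "r \<le> C * l2norm f" using op_bound_mapply(3)[OF assms f(1)] f(3) by simp
    also have "\<dots> \<le> C * 1" using f(2) op_bound_nonneg[OF assms] by (intro mult_left_mono)
    finally show "r \<le> C * 1" .
  qed
  have upper: "l2norm (mapply a f) \<le> opnorm a" if "f \<in> l2" "l2norm f \<le> 1" for f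
    unfolding opnorm_def using that by (intro cSup_upper bdd) blast
  have "0 \<le> opnorm a"
  proof -
    have "0 \<le> l2norm (mapply a (\<lambda>_. 0))"
      by (simp add: l2norm_def mapply_def)
    also have "\<dots> \<le> opnorm a" by (rule upper) (simp_all add: l2_def l2norm_def)
    finally show ?thesis .
  qed
  then show ?thesis
  proof (rule op_bound_of_finite_support)
    fix f :: "'a \<Rightarrow> complex" and G :: "'a set" assume G: "finite G"
    define k where "k = (\<lambda>y. if y \<in> G then f y else 0)"
    define s where "s = L2_set (\<lambda>y. cmod (f y)) G"
    have k: "k \<in> l2" "l2norm k = s"
      using l2_finite_support[OF G] by (auto simp: k_def s_def)
    have s0: "0 \<le> s" by (simp add: s_def L2_set_nonneg)
    have in_l2: "mapply a k \<in> l2" by (rule op_bound_mapply[OF assms k(1)])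
    have "l2norm (mapply a k) \<le> opnorm a * s"
    proof (cases "s = 0")
      case True
      then show ?thesis using op_bound_mapply(3)[OF assms k(1)] k(2) by simp
    next
      case False
      then have s: "0 < s" using s0 by simp
      \<comment> \<open>The normalised vector \<open>k / s\<close>, to which the supremum
        applies.\<close>
      define u where "u = (\<lambda>y. if y \<in> G then of_real (1/s) * f y else 0)"
      have "L2_set (\<lambda>y. cmod (of_real (1/s) * f y)) G = 1/s * s"
        using s unfolding s_def
        by (subst L2_set_right_distrib) (auto simp: norm_mult norm_divide)
      then have u: "u \<in> l2" "l2norm u \<le> 1"
        using l2_finite_support[OF G, of "\<lambda>y. of_real (1/s) * f y"] s by (auto simp: u_def)
      have ku: "k = (\<lambda>y. of_real s * u y)" using s by (auto simp: k_def u_def)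
      have m: "mapply a k = (\<lambda>x. of_real s * mapply a u x)"
        unfolding mapply_def ku by (simp add: mult.left_commute infsum_cmult_right')
      have "l2norm (mapply a k) = s * l2norm (mapply a u)"
        unfolding m l2norm_def using s
        by (simp add: norm_mult power_mult_distrib infsum_cmult_right' real_sqrt_mult)
      also have "\<dots> \<le> s * opnorm a" using s upper[OF u] by simp
      finally show ?thesis by (simp add: mult.commute)
    qed
    then show "mapply a k \<in> l2 \<and> l2norm (mapply a k) \<le> opnorm a * L2_set (\<lambda>y. cmod (f y)) G"
      using in_l2 by (simp add: s_def)
  qed
qed

section \<open>The uniform Roe algebra\<close>

lemma infsum_diff_summable:
  fixes f g :: "'a \<Rightarrow> 'b::{topological_ab_group_add, t2_space}"
  assumes "f summable_on A" "g summable_on A"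
  shows "infsum (\<lambda>x. f x - g x) A = infsum f A - infsum g A"
  using infsum_add[of f A "\<lambda>x. - g x"] assms by (simp add: summable_on_uminus infsum_uminus)

lemma mmult_diff_right:
  assumes "op_bound A a" "op_bound B b" "op_bound C c"
  shows "mmult a (\<lambda>x y. b x y - c x y) = (\<lambda>x y. mmult a b x y - mmult a c x y)"
  unfolding mmult_def using mmult_summable[OF assms(1,2)] mmult_summable[OF assms(1,3)]
  by (simp add: right_diff_distrib infsum_diff_summable)

lemma mmult_diff_left:
  assumes "op_bound A a" "op_bound B b" "op_bound C c"
  shows "mmult (\<lambda>x y. b x y - c x y) a = (\<lambda>x y. mmult b a x y - mmult c a x y)"
  unfolding mmult_def using mmult_summable[OF assms(2,1)] mmult_summable[OF assms(3,1)]
  by (simp add: left_diff_distrib infsum_diff_summable)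

lemma mmult_diag_left: "mmult (\<lambda>x y. if x = y then d x else 0) a = (\<lambda>x y. d x * a x y)"
proof (intro ext)
  fix x z
  show "mmult (\<lambda>x y. if x = y then d x else 0) a x z = d x * a x z"
    unfolding mmult_def
    by (rule infsumI, rule has_sum_finite_neutralI[of "{x}"]) auto
qed

lemma mmult_diag_right: "mmult a (\<lambda>x y. if x = y then d x else 0) = (\<lambda>x y. a x y * d y)"
proof (intro ext)
  fix x z
  show "mmult a (\<lambda>x y. if x = y then d x else 0) x z = a x z * d z"
    unfolding mmult_def
    by (rule infsumI, rule has_sum_finite_neutralI[of "{z}"]) auto
qed

lemma mmult_mid: "mmult mid a = a" "mmult a mid = a"
  unfolding mid_def by (simp_all add: mmult_diag_left[where d="\<lambda>_. 1"] mmult_diag_right[where d="\<lambda>_. 1"])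

lemma madj_mmult: "madj (mmult a b) = mmult (madj b) (madj a)"
  unfolding madj_def mmult_def by (simp add: mult.commute flip: infsum_cnj)

section \<open>Finite propagation under the algebra operations\<close>

lemma finite_prop_mmult:
  assumes "finite_prop a" "finite_prop b"
  shows "finite_prop (mmult a b)"
proof -
  obtain R where R: "\<And>x y. a x y \<noteq> 0 \<Longrightarrow> dist x y \<le> R"
    using assms(1) unfolding finite_prop_def by blast
  obtain S where S: "\<And>x y. b x y \<noteq> 0 \<Longrightarrow> dist x y \<le> S"
    using assms(2) unfolding finite_prop_def by blast
  have "dist x z \<le> R + S" if nz: "mmult a b x z \<noteq> 0" for x z
  proof -
    obtain y where "a x y * b y z \<noteq> 0"
      using nz unfolding mmult_def by (meson infsum_0)
    then show ?thesis using R[of x y] S[of y z] dist_triangle[of x z y] by simp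
  qed
  then show ?thesis unfolding finite_prop_def by blast
qed

lemma finite_prop_lincomb:
  assumes "finite_prop a" "finite_prop b"
  shows "finite_prop (\<lambda>x y. a x y + c * b x y)"
proof -
  obtain R where R: "\<And>x y. a x y \<noteq> 0 \<Longrightarrow> dist x y \<le> R"
    using assms(1) unfolding finite_prop_def by blast
  obtain S where S: "\<And>x y. b x y \<noteq> 0 \<Longrightarrow> dist x y \<le> S"
    using assms(2) unfolding finite_prop_def by blast
  have "dist x y \<le> max R S" if "a x y + c * b x y \<noteq> 0" for x y
    using that R[of x y] S[of x y] by (cases "a x y = 0") (auto simp: le_max_iff_disj)
  then show ?thesis unfolding finite_prop_def by blast
qed

lemma finite_prop_madj: "finite_prop a \<Longrightarrow> finite_prop (madj a)"
  unfolding finite_prop_def madj_def by (metis complex_cnj_zero dist_commute)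

lemma roe_alg_iff: "a \<in> roe_alg \<longleftrightarrow> (\<exists>C. op_bound C a) \<and> finite_prop a"
  by (simp add: roe_alg_def bdd_op_iff_op_bound)

text \<open>Trades \<open>opnorm\<close> for \<open>op_bound\<close>, so that later closure
  arguments only add and multiply admissible constants.\<close>

lemma uroe_iff:
  "a \<in> uroe \<longleftrightarrow> (\<exists>C. op_bound C a) \<and>
     (\<forall>e>0. \<exists>b\<in>roe_alg. op_bound e (\<lambda>x y. a x y - b x y))"
proof (intro iffI conjI allI impI)
  assume a: "a \<in> uroe"
  then obtain C where C: "op_bound C a" by (auto simp: uroe_def bdd_op_iff_op_bound)
  then show "\<exists>C. op_bound C a" ..
  fix e :: real assume "0 < e"
  then obtain b where b: "b \<in> roe_alg" "opnorm (\<lambda>x y. a x y - b x y) < e"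
    using a by (auto simp: uroe_def)
  obtain D where "op_bound D b" using b(1) by (auto simp: roe_alg_iff)
  from op_bound_opnorm[OF op_bound_diff[OF C this]] b
  show "\<exists>b\<in>roe_alg. op_bound e (\<lambda>x y. a x y - b x y)"
    by (meson less_imp_le op_bound_mono)
next
  assume a: "(\<exists>C. op_bound C a) \<and> (\<forall>e>0. \<exists>b\<in>roe_alg. op_bound e (\<lambda>x y. a x y - b x y))"
  have "\<exists>b\<in>roe_alg. opnorm (\<lambda>x y. a x y - b x y) < e" if e: "0 < e" for e
  proof -
    \<comment> \<open>Halving \<open>e\<close> turns the non-strict bound into the strict inequality
      required by \<open>uroe\<close>.\<close>
    obtain b where b: "b \<in> roe_alg" "op_bound (e/2) (\<lambda>x y. a x y - b x y)"
      using a half_gt_zero[OF e] by blast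
    have "opnorm (\<lambda>x y. a x y - b x y) < e" using opnorm_le[OF b(2)] e by simp
    then show ?thesis using b(1) by blast
  qed
  then show "a \<in> uroe" using a by (simp add: uroe_def bdd_op_iff_op_bound)
qed

lemma roe_alg_subset_uroe: "roe_alg \<subseteq> uroe"
proof
  fix a :: "'a::metric_space \<Rightarrow> 'a \<Rightarrow> complex" assume a: "a \<in> roe_alg"
  have "op_bound e (\<lambda>x y. a x y - a x y)" if "0 < e" for e
    using op_bound_mono[OF op_bound_zero, of e] that by simp
  then have "\<forall>e>0. \<exists>b\<in>roe_alg. op_bound e (\<lambda>x y. a x y - b x y)"
    by (intro allI impI bexI[OF _ a])
  moreover have "\<exists>C. op_bound C a" using a by (simp add: roe_alg_iff)
  ultimately show "a \<in> uroe" by (simp add: uroe_iff)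
qed

lemma diag_in_roe_alg:
  assumes "\<And>x. cmod (d x) \<le> C"
  shows "(\<lambda>x y. if x = y then d x else 0) \<in> roe_alg"
proof -
  have "op_bound C (\<lambda>x y. if x = y then d x else 0)"
    using assms order_trans[OF norm_ge_zero] by (intro op_bound_diag) blast+
  moreover have "finite_prop (\<lambda>x y. if x = y then d x else 0)"
    unfolding finite_prop_def by (rule exI[of _ 0]) simp
  ultimately show ?thesis by (auto simp: roe_alg_iff)
qed

lemma cond_exp_in_uroe: "a \<in> uroe \<Longrightarrow> cond_exp a \<in> uroe"
  unfolding cond_exp_def
  using diag_in_roe_alg[of "\<lambda>x. a x x"] op_bound_entry roe_alg_subset_uroe
  by (metis (no_types, lifting) subsetD uroe_iff)

lemma op_bound_cond_exp: "op_bound C a \<Longrightarrow> op_bound C (cond_exp a)"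
  unfolding cond_exp_def by (intro op_bound_diag op_bound_entry op_bound_nonneg)

lemma mid_in_uroe: "mid \<in> uroe"
  using diag_in_roe_alg[of "\<lambda>_. 1" 1] roe_alg_subset_uroe by (auto simp: mid_def)

lemma uroe_lincomb:
  assumes "a \<in> uroe" "b \<in> uroe"
  shows "(\<lambda>x y. a x y + c * b x y) \<in> uroe"
  unfolding uroe_iff
proof (intro conjI allI impI)
  obtain A B where AB: "op_bound A a" "op_bound B b" using assms by (auto simp: uroe_iff)
  show "\<exists>C. op_bound C (\<lambda>x y. a x y + c * b x y)"
    using op_bound_add[OF AB(1) op_bound_scale[OF AB(2)]] ..
  fix e :: real assume e: "0 < e"
  obtain a' where a': "a' \<in> roe_alg" "op_bound (e/2) (\<lambda>x y. a x y - a' x y)"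
    using assms(1) half_gt_zero[OF e] unfolding uroe_iff by blast
  \<comment> \<open>The summand 1 keeps the denominator positive when \<open>c = 0\<close>.\<close>
  have "0 < e / (2 * (cmod c + 1))" using e by (simp add: add_nonneg_pos)
  then obtain b' where b': "b' \<in> roe_alg"
      "op_bound (e / (2 * (cmod c + 1))) (\<lambda>x y. b x y - b' x y)"
    using assms(2) unfolding uroe_iff by blast
  have "cmod c * (e / (2 * (cmod c + 1))) \<le> e/2"
    using e add_nonneg_pos[of "cmod c" 1] by (simp add: field_simps)
  then have "op_bound (e/2 + e/2) (\<lambda>x y. (a x y - a' x y) + c * (b x y - b' x y))"
    by (intro op_bound_add a' op_bound_mono[OF op_bound_scale[OF b'(2)]])
  then have "op_bound e (\<lambda>x y. (a x y + c * b x y) - (a' x y + c * b' x y))"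
    by (simp add: algebra_simps)
  moreover have "(\<lambda>x y. a' x y + c * b' x y) \<in> roe_alg"
  proof -
    obtain A B where AB: "op_bound A a'" "op_bound B b'" using a'(1) b'(1) by (auto simp: roe_alg_iff)
    have "\<exists>C. op_bound C (\<lambda>x y. a' x y + c * b' x y)"
      using op_bound_add[OF AB(1) op_bound_scale[OF AB(2)]] ..
    then show ?thesis using a'(1) b'(1) by (simp add: roe_alg_iff finite_prop_lincomb)
  qed
  ultimately show "\<exists>b'\<in>roe_alg. op_bound e (\<lambda>x y. (a x y + c * b x y) - b' x y)"
    by (rule bexI)
qed

lemma uroe_diff:
  assumes "a \<in> uroe" "b \<in> uroe"
  shows "(\<lambda>x y. a x y - b x y) \<in> uroe"
  using uroe_lincomb[OF assms, of "-1"] by simp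

lemma uroe_scale:
  assumes "a \<in> uroe"
  shows "(\<lambda>x y. c * a x y) \<in> uroe"
  using uroe_lincomb[OF assms assms, of "c - 1"] by (simp add: algebra_simps)

text \<open>Uses \<open>a b - a' b' = a (b - b') + (a - a') b'\<close>. The approximant
  \<open>b'\<close> is chosen first, because the tolerance for \<open>a'\<close> depends on a bound
  for \<open>b'\<close>.\<close>

lemma uroe_mmult:
  assumes "a \<in> uroe" "b \<in> uroe"
  shows "mmult a b \<in> uroe"
  unfolding uroe_iff
proof (intro conjI allI impI)
  obtain C D where C: "op_bound C a" and D: "op_bound D b"
    using assms by (auto simp: uroe_iff)
  then show "\<exists>C. op_bound C (mmult a b)" using op_bound_mmult by blast
  fix e :: real assume e: "0 < e"
  have C0: "0 \<le> C" using C op_bound_nonneg by blast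
  have "0 < e / (2 * (C + 1))" using e C0 by (simp add: add_nonneg_pos)
  then obtain b' where b': "b' \<in> roe_alg" "op_bound (e / (2 * (C + 1))) (\<lambda>x y. b x y - b' x y)"
    using assms(2) unfolding uroe_iff by blast
  obtain D' where D': "op_bound D' b'" using b'(1) by (auto simp: roe_alg_iff)
  have D0: "0 \<le> D'" using D' op_bound_nonneg by blast
  have "0 < e / (2 * (D' + 1))" using e D0 by (simp add: add_nonneg_pos)
  then obtain a' where a': "a' \<in> roe_alg" "op_bound (e / (2 * (D' + 1))) (\<lambda>x y. a x y - a' x y)"
    using assms(1) unfolding uroe_iff by blast
  obtain C' where C': "op_bound C' a'" using a'(1) by (auto simp: roe_alg_iff)
  have "C * (e / (2 * (C + 1))) \<le> e/2" "e / (2 * (D' + 1)) * D' \<le> e/2"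
    using e C0 D0 by (simp_all add: field_simps)
  then have "op_bound (e/2 + e/2) (\<lambda>x y. mmult a (\<lambda>x y. b x y - b' x y) x y
      + mmult (\<lambda>x y. a x y - a' x y) b' x y)"
    by (intro op_bound_add op_bound_mono[OF op_bound_mmult[OF C b'(2)]]
        op_bound_mono[OF op_bound_mmult[OF a'(2) D']])
  then have "op_bound e (\<lambda>x y. mmult a b x y - mmult a' b' x y)"
    by (simp add: mmult_diff_right[OF C D D'] mmult_diff_left[OF D' C C'])
  moreover have "mmult a' b' \<in> roe_alg"
    using op_bound_mmult[OF C' D'] finite_prop_mmult a'(1) b'(1) unfolding roe_alg_iff by blast
  ultimately show "\<exists>c\<in>roe_alg. op_bound e (\<lambda>x y. mmult a b x y - c x y)" by blast
qed

lemma uroe_madj: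
  assumes "a \<in> uroe"
  shows "madj a \<in> uroe"
  unfolding uroe_iff
proof (intro conjI allI impI)
  show "\<exists>C. op_bound C (madj a)" using assms op_bound_madj by (auto simp: uroe_iff)
  fix e :: real assume e: "0 < e"
  then obtain b where b: "b \<in> roe_alg" "op_bound e (\<lambda>x y. a x y - b x y)"
    using assms unfolding uroe_iff by blast
  have "op_bound e (\<lambda>x y. madj a x y - madj b x y)"
    using op_bound_madj[OF b(2)] by (simp add: madj_def)
  moreover have "madj b \<in> roe_alg"
    using b(1) op_bound_madj finite_prop_madj unfolding roe_alg_iff by blast
  ultimately show "\<exists>b\<in>roe_alg. op_bound e (\<lambda>x y. madj a x y - b x y)" by blast
qed

text \<open>Norm limits stay in the algebra; this is what places the limit of the square-root
  iteration in \<open>uroe\<close>.\<close>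

lemma uroe_closed:
  assumes "op_bound C a" "\<And>e. 0 < e \<Longrightarrow> \<exists>b\<in>uroe. op_bound e (\<lambda>x y. a x y - b x y)"
  shows "a \<in> uroe"
  unfolding uroe_iff
proof (intro conjI allI impI)
  show "\<exists>C. op_bound C a" using assms(1) ..
  fix e :: real assume e: "0 < e"
  obtain b where b: "b \<in> uroe" "op_bound (e/2) (\<lambda>x y. a x y - b x y)"
    using assms(2)[OF half_gt_zero[OF e]] by blast
  obtain c where c: "c \<in> roe_alg" "op_bound (e/2) (\<lambda>x y. b x y - c x y)"
    using b(1) half_gt_zero[OF e] unfolding uroe_iff by blast
  have "op_bound e (\<lambda>x y. a x y - c x y)" using op_bound_add[OF b(2) c(2)] by simp
  then show "\<exists>c\<in>roe_alg. op_bound e (\<lambda>x y. a x y - c x y)" using c(1) by blast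
qed

section \<open>Boundedness of states\<close>

text \<open>The limit \<open>y\<close> of this iteration satisfies \<open>2 y = x + y\<^sup>2\<close>, that is, \<open>(1 - y)\<^sup>2 = 1 - x\<close>.\<close>

primrec sqrt_iter :: "('a \<Rightarrow> 'a \<Rightarrow> complex) \<Rightarrow> nat \<Rightarrow> 'a \<Rightarrow> 'a \<Rightarrow> complex" where
  "sqrt_iter x 0 = (\<lambda>i j. 0)"
| "sqrt_iter x (Suc n) = (\<lambda>i j. (1/2) * (x i j + mmult (sqrt_iter x n) (sqrt_iter x n) i j))"

text \<open>The ball of radius 1/2 is invariant: one step gives at most
  \<open>(1/2) * (1/2 + 1/4) = 3/8\<close>.\<close>

lemma op_bound_sqrt_iter:
  assumes "op_bound (1/2) x"
  shows "op_bound (1/2) (sqrt_iter x n)"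
proof (induction n)
  case 0
  then show ?case by (simp add: op_bound_mono[OF op_bound_zero])
next
  case (Suc n)
  show ?case
    using op_bound_mono[OF op_bound_scale[OF op_bound_add[OF assms op_bound_mmult[OF Suc Suc]],
        of "1/2"], of "1/2"] by simp
qed

text \<open>A difference of squares without commutativity:
  \<open>a (a - b) + (a - b) b\<close>.\<close>

lemma mmult_square_diff:
  assumes "op_bound A a" "op_bound B b"
  shows "(\<lambda>i j. mmult a (\<lambda>i j. a i j - b i j) i j + mmult (\<lambda>i j. a i j - b i j) b i j)
    = (\<lambda>i j. mmult a a i j - mmult b b i j)"
  by (simp add: mmult_diff_right[OF assms(1,1,2)] mmult_diff_left[OF assms(2,1,2)])

text \<open>Each of the two products contributes \<open>C/2\<close>, so squaring is 1-Lipschitz on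
  the ball of radius 1/2. The factor 1/2 in the iteration then makes it a contraction.\<close>

lemma op_bound_square_diff:
  assumes "op_bound (1/2) a" "op_bound (1/2) b" "op_bound C (\<lambda>i j. a i j - b i j)"
  shows "op_bound C (\<lambda>i j. mmult a a i j - mmult b b i j)"
  using op_bound_add[OF op_bound_mmult[OF assms(1,3)] op_bound_mmult[OF assms(3,2)]]
  by (simp add: mmult_square_diff[OF assms(1,2)])

lemma op_bound_sqrt_iter_step:
  assumes "op_bound (1/2) x"
  shows "op_bound ((1/2)^n) (\<lambda>i j. sqrt_iter x (Suc n) i j - sqrt_iter x n i j)"
proof (induction n)
  case 0
  have "mmult (\<lambda>i j. 0) (\<lambda>i j. 0) = (\<lambda>(i::'a) (j::'a). 0::complex)" by (simp add: mmult_def)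
  then show ?case
    using op_bound_mono[OF op_bound_scale[OF assms, of "1/2"], of 1] by simp
next
  case (Suc n)
  note b = op_bound_sqrt_iter[OF assms]
  have "op_bound ((1/2) * (1/2)^n) (\<lambda>i j. (1/2) *
      (mmult (sqrt_iter x (Suc n)) (sqrt_iter x (Suc n)) i j
        - mmult (sqrt_iter x n) (sqrt_iter x n) i j))"
    using op_bound_scale[OF op_bound_square_diff[OF b b Suc], of "1/2"] by (simp del: sqrt_iter.simps)
  then show ?case by (simp add: algebra_simps)
qed

lemma op_bound_sqrt_iter_diff:
  assumes "op_bound (1/2) x"
  shows "op_bound (2 * (1/2)^n) (\<lambda>i j. sqrt_iter x (n + k) i j - sqrt_iter x n i j)"
proof -
  \<comment> \<open>The exact value of the geometric sum from \<open>n\<close> to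
    \<open>n + k - 1\<close>; the induction on \<open>k\<close> needs it in place of the weaker
    final bound.\<close>
  have "op_bound (2 * (1/2)^n - 2 * (1/2)^(n+k))
      (\<lambda>i j. sqrt_iter x (n + k) i j - sqrt_iter x n i j)"
  proof (induction k)
    case 0
    then show ?case by (simp add: op_bound_zero)
  next
    case (Suc k)
    show ?case
      using op_bound_add[OF op_bound_sqrt_iter_step[OF assms, of "n+k"] Suc]
      by (simp del: sqrt_iter.simps)
  qed
  then show ?thesis by (rule op_bound_mono) simp
qed

lemma sqrt_iter_in_uroe: "x \<in> uroe \<Longrightarrow> sqrt_iter x n \<in> uroe"
proof (induction n)
  case 0
  then show ?case using uroe_scale[of x 0] by simp
next
  case (Suc n)
  then show ?case
    using uroe_scale[OF uroe_lincomb[OF Suc.prems uroe_mmult[OF Suc.IH Suc.IH], of 1], of "1/2"]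
    by simp
qed

lemma madj_sqrt_iter:
  assumes "madj x = x"
  shows "madj (sqrt_iter x n) = sqrt_iter x n"
proof (induction n)
  case 0
  then show ?case by (simp add: madj_def)
next
  case (Suc n)
  let ?m = "mmult (sqrt_iter x n) (sqrt_iter x n)"
  have m: "madj ?m = ?m" by (simp add: madj_mmult Suc)
  have "cnj (x j i) = x i j" "cnj (?m j i) = ?m i j" for i j
    using fun_cong[OF fun_cong[OF assms]] fun_cong[OF fun_cong[OF m]] by (simp_all add: madj_def)
  then show ?case by (simp add: madj_def)
qed

text \<open>Take \<open>d = 1 - y\<close> with \<open>y\<close> the limit of
  \<open>sqrt_iter x\<close>. The limit is first formed entrywise, then shown to be a norm limit,
  self-adjoint and a solution of \<open>2 y - y y = x\<close>; hence
  \<open>d d = 1 - x\<close>.\<close>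

lemma one_minus_eq_square:
  assumes x: "x \<in> uroe" "op_bound (1/2) x" "madj x = x"
  shows "\<exists>d\<in>uroe. mmult (madj d) d = (\<lambda>i j. mid i j - x i j)"
proof -
  let ?s = "sqrt_iter x"
  have s: "op_bound (1/2) (?s n)" for n by (rule op_bound_sqrt_iter[OF x(2)])
  have diff: "op_bound (2 * (1/2)^n) (\<lambda>i j. ?s (n + k) i j - ?s n i j)" for n k
    by (rule op_bound_sqrt_iter_diff[OF x(2)])
  have null: "(\<lambda>n. 2 * (1/2::real)^n) \<longlonglongrightarrow> 0"
    using tendsto_mult_right_zero[OF LIMSEQ_power_zero[of "1/2::real"], of 2] by simp
  have "convergent (\<lambda>n. ?s n i j)" for i j
  proof (rule Cauchy_convergent, rule metric_CauchyI)
    fix e :: real assume "0 < e"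
    then have "\<forall>\<^sub>F n in sequentially. 2 * (1/2::real)^n < e/2"
      using order_tendstoD(2)[OF null, of "e/2"] by simp
    then obtain N where N: "2 * (1/2::real)^N < e/2"
      by (auto simp: eventually_sequentially)
    have *: "dist (?s m i j) (?s N i j) < e/2" if m: "m \<ge> N" for m
      using op_bound_entry[OF diff[of N "m - N"], of i j] N m by (simp add: dist_norm)
    show "\<exists>M. \<forall>m\<ge>M. \<forall>n\<ge>M. dist (?s m i j) (?s n i j) < e"
      using dist_triangle_half_l[OF *] by (metis * dist_commute dist_triangle_half_r)
  qed
  then obtain y where y: "\<And>i j. (\<lambda>n. ?s n i j) \<longlonglongrightarrow> y i j"
    unfolding convergent_def by metis
  have yb: "op_bound (1/2) y" by (rule op_bound_limit[OF s y])
  \<comment> \<open>Letting the later index tend to infinity with \<open>n\<close> fixed upgrades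
    entrywise convergence to a norm estimate.\<close>
  have yd: "op_bound (2 * (1/2)^n) (\<lambda>i j. y i j - ?s n i j)" for n
  proof (rule op_bound_limit)
    show "op_bound (2 * (1/2)^n) (\<lambda>i j. ?s (k + n) i j - ?s n i j)" for k
      using diff[of n k] by (simp add: add.commute)
    show "(\<lambda>k. ?s (k + n) i j - ?s n i j) \<longlonglongrightarrow> y i j - ?s n i j" for i j
      using LIMSEQ_ignore_initial_segment[OF y] by (intro tendsto_intros)
  qed
  have yu: "y \<in> uroe"
  proof (rule uroe_closed[OF yb])
    fix e :: real assume "0 < e"
    then have "\<forall>\<^sub>F n in sequentially. 2 * (1/2::real)^n < e"
      by (rule order_tendstoD(2)[OF null])
    then obtain n where "2 * (1/2::real)^n < e" by (auto simp: eventually_sequentially)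
    then have "op_bound e (\<lambda>i j. y i j - ?s n i j)" using op_bound_mono[OF yd] by simp
    then show "\<exists>b\<in>uroe. op_bound e (\<lambda>i j. y i j - b i j)"
      using sqrt_iter_in_uroe[OF x(1)] by blast
  qed
  \<comment> \<open>An entry of a product is an infinite sum, so entrywise convergence of the
    factors would not suffice; the norm estimate \<open>yd\<close> is used.\<close>
  have "(\<lambda>n. mmult (?s n) (?s n) i j) \<longlonglongrightarrow> mmult y y i j" for i j
  proof -
    have "cmod (mmult (?s n) (?s n) i j - mmult y y i j) \<le> 2 * (1/2)^n" for n
      using op_bound_entry[OF op_bound_square_diff[OF yb s yd[of n]], of i j]
      by (simp add: norm_minus_commute)
    then have "(\<lambda>n. mmult (?s n) (?s n) i j - mmult y y i j) \<longlonglongrightarrow> 0"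
      by (intro Lim_null_comparison[OF _ null]) auto
    then show ?thesis using LIM_zero_iff by blast
  qed
  then have "(\<lambda>n. ?s (Suc n) i j) \<longlonglongrightarrow> (1/2) * (x i j + mmult y y i j)" for i j
    unfolding sqrt_iter.simps by (intro tendsto_intros)
  then have fixpt: "y i j = (1/2) * (x i j + mmult y y i j)" for i j
    using LIMSEQ_unique LIMSEQ_Suc[OF y] by blast
  have two: "2 * y i j - mmult y y i j = x i j" for i j
    by (subst fixpt) (simp add: field_simps)
  have ysa: "cnj (y j i) = y i j" for i j
  proof (rule LIMSEQ_unique[OF _ y])
    have "cnj (?s n j i) = ?s n i j" for n
      using fun_cong[OF fun_cong[OF madj_sqrt_iter[OF x(3)]]] by (simp add: madj_def)
    then show "(\<lambda>n. ?s n i j) \<longlonglongrightarrow> cnj (y j i)"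
      using tendsto_cnj[OF y[of j i]] by simp
  qed
  define d where "d = (\<lambda>i j. mid i j - y i j)"
  have du: "d \<in> uroe" unfolding d_def by (rule uroe_diff[OF mid_in_uroe yu])
  have "cnj (mid j i) = mid i j" for i j :: 'a by (simp add: mid_def)
  then have dsa: "madj d = d" using ysa by (simp add: madj_def d_def)
  have db: "op_bound (1 + 1/2) d" unfolding d_def by (rule op_bound_diff[OF op_bound_mid yb])
  \<comment> \<open>Only the left factor is expanded here, giving \<open>d - y d\<close>; the
    product \<open>y d\<close> is expanded next.\<close>
  have "mmult d d = (\<lambda>i j. mmult mid d i j - mmult y d i j)"
    by (subst (1) d_def) (rule mmult_diff_left[OF db op_bound_mid yb])
  also have "mmult y d = (\<lambda>i j. mmult y mid i j - mmult y y i j)"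
    unfolding d_def by (rule mmult_diff_right[OF yb op_bound_mid yb])
  finally have "mmult d d = (\<lambda>i j. mid i j - (2 * y i j - mmult y y i j))"
    by (simp add: mmult_mid d_def algebra_simps)
  also have "\<dots> = (\<lambda>i j. mid i j - x i j)"
    by (simp add: two)
  finally show ?thesis using du dsa by (intro bexI[of _ d]) simp_all
qed

section \<open>Linearity and norm bounds of states\<close>

lemma state_lincomb:
  assumes "is_state \<phi>" "a \<in> uroe" "b \<in> uroe"
  shows "\<phi> (\<lambda>x y. a x y + c * b x y) = \<phi> a + c * \<phi> b"
  using assms unfolding is_state_def by blast

lemma state_diff:
  assumes "is_state \<phi>" "a \<in> uroe" "b \<in> uroe"
  shows "\<phi> (\<lambda>x y. a x y - b x y) = \<phi> a - \<phi> b"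
  using state_lincomb[OF assms, of "-1"] by simp

lemma state_zero:
  assumes "is_state \<phi>"
  shows "\<phi> (\<lambda>x y. 0) = 0"
  using state_diff[OF assms mid_in_uroe mid_in_uroe] by simp

lemma zero_in_uroe: "(\<lambda>x y. 0) \<in> uroe"
  using uroe_scale[OF mid_in_uroe, of 0] by simp

lemma state_scale:
  assumes "is_state \<phi>" "a \<in> uroe"
  shows "\<phi> (\<lambda>x y. c * a x y) = c * \<phi> a"
  using state_lincomb[OF assms(1) zero_in_uroe assms(2), of c] by (simp add: state_zero[OF assms(1)])

lemma state_sum:
  assumes "is_state \<phi>" "finite I" "\<And>i. i \<in> I \<Longrightarrow> a i \<in> uroe"
  shows "(\<lambda>x y. \<Sum>i\<in>I. a i x y) \<in> uroe \<and> \<phi> (\<lambda>x y. \<Sum>i\<in>I. a i x y) = (\<Sum>i\<in>I. \<phi> (a i))"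
  using assms(2,3)
proof (induction I)
  case empty
  then show ?case by (simp add: zero_in_uroe state_zero[OF assms(1)])
next
  case (insert i I)
  then show ?case
    using uroe_lincomb[of "a i" "\<lambda>x y. \<Sum>i\<in>I. a i x y" 1]
      state_lincomb[OF assms(1), of "a i" "\<lambda>x y. \<Sum>i\<in>I. a i x y" 1] by simp
qed

text \<open>\<open>1 - x\<close> has the form \<open>d\<^sup>* d\<close>, so positivity makes
  \<open>1 - \<phi> x\<close> real and nonnegative.\<close>

lemma state_bound_selfadjoint_half:
  assumes "is_state \<phi>" "x \<in> uroe" "op_bound (1/2) x" "madj x = x"
  shows "Im (\<phi> x) = 0 \<and> Re (\<phi> x) \<le> 1"
proof -
  obtain d where d: "d \<in> uroe" "mmult (madj d) d = (\<lambda>i j. mid i j - x i j)"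
    using one_minus_eq_square[OF assms(2-4)] by blast
  have "\<phi> (mmult (madj d) d) = 1 - \<phi> x"
    using state_diff[OF assms(1) mid_in_uroe assms(2)] assms(1) d(2) by (simp add: is_state_def)
  moreover have "Im (\<phi> (mmult (madj d) d)) = 0" "Re (\<phi> (mmult (madj d) d)) \<ge> 0"
    using assms(1) d(1) unfolding is_state_def by blast+
  ultimately show ?thesis by simp
qed

text \<open>Scaling by \<open>r = 1/(2C)\<close> and by its negative brings \<open>x\<close> into
  the ball of radius 1/2; the two signs bound \<open>\<phi> x\<close> from above and below.\<close>

lemma state_bound_selfadjoint:
  assumes st: "is_state \<phi>" and x: "x \<in> uroe" "op_bound C x" "madj x = x" and C: "0 < C"
  shows "cmod (\<phi> x) \<le> 2 * C"
proof -
  have main: "Im (\<phi> x) = 0 \<and> r * Re (\<phi> x) \<le> 1" if r: "\<bar>r\<bar> = 1 / (2 * C)" for r :: real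
  proof -
    let ?z = "\<lambda>i j. of_real r * x i j"
    have z: "?z \<in> uroe" by (rule uroe_scale[OF x(1)])
    have "op_bound (1/2) ?z"
      using op_bound_scale[OF x(2), of "of_real r"] r C by simp
    moreover have "madj ?z = ?z"
      using fun_cong[OF fun_cong[OF x(3)]] by (simp add: madj_def)
    ultimately have "Im (\<phi> ?z) = 0 \<and> Re (\<phi> ?z) \<le> 1"
      using state_bound_selfadjoint_half[OF st z] by blast
    then show ?thesis using r C by (auto simp: state_scale[OF st x(1)])
  qed
  have "Im (\<phi> x) = 0" "1 / (2*C) * Re (\<phi> x) \<le> 1" "- (1 / (2*C)) * Re (\<phi> x) \<le> 1"
    using main[of "1 / (2*C)"] main[of "- (1 / (2*C))"] C by auto
  then show ?thesis using C by (simp add: cmod_eq_Re field_simps abs_le_iff)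
qed

text \<open>Splits \<open>a = u + \<i> v\<close> into self-adjoint parts, each again bounded by
  \<open>C\<close>. The constant 4 is not sharp; any fixed multiple of \<open>C\<close> serves the
  density argument.\<close>

lemma state_bound:
  assumes st: "is_state \<phi>" and a: "a \<in> uroe" "op_bound C a" and C: "0 < C"
  shows "cmod (\<phi> a) \<le> 4 * C"
proof -
  define u where "u = (\<lambda>i j. (1/2) * (a i j + madj a i j))"
  define v where "v = (\<lambda>i j. (- \<i>/2) * (a i j - madj a i j))"
  have u: "u \<in> uroe" "op_bound C u" "madj u = u"
    using uroe_scale[OF uroe_lincomb[OF a(1) uroe_madj[OF a(1)], of 1], of "1/2"]
      op_bound_scale[OF op_bound_add[OF a(2) op_bound_madj[OF a(2)]], of "1/2"]
    by (auto simp: u_def madj_def add.commute)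
  have v: "v \<in> uroe" "op_bound C v" "madj v = v"
    using uroe_scale[OF uroe_diff[OF a(1) uroe_madj[OF a(1)]], of "-\<i>/2"]
      op_bound_scale[OF op_bound_diff[OF a(2) op_bound_madj[OF a(2)]], of "-\<i>/2"]
    by (auto simp: v_def madj_def algebra_simps)
  have "a = (\<lambda>i j. u i j + \<i> * v i j)" by (simp add: u_def v_def algebra_simps)
  then have "\<phi> a = \<phi> u + \<i> * \<phi> v" using state_lincomb[OF st u(1) v(1), of \<i>] by simp
  then have "cmod (\<phi> a) \<le> cmod (\<phi> u) + cmod (\<phi> v)"
    using norm_triangle_ineq[of "\<phi> u" "\<i> * \<phi> v"] by (simp add: norm_mult)
  then show ?thesis
    using state_bound_selfadjoint[OF st u C] state_bound_selfadjoint[OF st v C] by simp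
qed

section \<open>KMS states and diagonal projections\<close>

lemma opnorm_zero: "opnorm (\<lambda>x y. 0) = 0"
  by (rule antisym[OF opnorm_le[OF op_bound_zero]
        op_bound_nonneg[OF op_bound_opnorm[OF op_bound_zero]]])

text \<open>On a diagonal matrix the two phases of the flow cancel, so the constant map is an entire
  extension with derivative 0. Its value at \<open>\<i> \<beta>\<close> is the matrix itself, and
  the KMS identity becomes a trace identity.\<close>

lemma KMS_diag_commute:
  fixes a :: "'a::metric_space \<Rightarrow> 'a \<Rightarrow> complex"
  assumes K: "is_KMS h \<beta> \<phi>" and a: "a \<in> uroe" and d: "\<And>x. cmod (d x) \<le> C"
  shows "\<phi> (\<lambda>x y. a x y * d y) = \<phi> (\<lambda>x y. d x * a x y)"
proof -
  let ?p = "\<lambda>x y. if x = y then d x else 0"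
  have p: "?p \<in> uroe" by (rule subsetD[OF roe_alg_subset_uroe diag_in_roe_alg[OF d]])
  have fl: "flow h t ?p = ?p" for t
  proof (intro ext)
    fix x y
    show "flow h t ?p x y = ?p x y"
      unfolding flow_def by (cases "x = y") (simp_all add: exp_minus)
  qed
  have "\<exists>D. bdd_op D \<and>
      ((\<lambda>w. opnorm (\<lambda>x y. (?p x y - ?p x y) / w - D x y)) \<longlongrightarrow> 0) (at (0::complex))"
  proof (intro exI conjI)
    show "bdd_op (\<lambda>(x::'a) (y::'a). 0)" by (rule op_bound_imp_bdd_op[OF op_bound_zero])
    show "((\<lambda>w. opnorm (\<lambda>x y. (?p x y - ?p x y) / w - 0)) \<longlongrightarrow> 0) (at (0::complex))"
      by (simp only: diff_self div_0 opnorm_zero tendsto_const)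
  qed
  then have "entire_ext h ?p (\<lambda>_. ?p)"
    unfolding entire_ext_def fl using p by (intro conjI allI refl)
  then have "\<phi> (mmult a ?p) = \<phi> (mmult ?p a)"
    using K a p unfolding is_KMS_def by blast
  then show ?thesis by (simp only: mmult_diag_left mmult_diag_right)
qed

text \<open>Greedy colouring along a well-order: a point has fewer than \<open>Suc N\<close> neighbours.\<close>

lemma ulf_colouring:
  assumes "ulf TYPE('a::metric_space)"
  shows "\<exists>(col :: 'a \<Rightarrow> nat) N. (\<forall>x. col x \<le> N) \<and>
    (\<forall>x y. x \<noteq> y \<longrightarrow> dist x y \<le> R \<longrightarrow> col x \<noteq> col y)"
proof -
  \<comment> \<open>The radius is positive for every \<open>R\<close>, and the open ball contains
    all points at distance at most \<open>R\<close>.\<close>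
  obtain N where N: "\<And>x::'a. finite (ball x (max R 0 + 1)) \<and> card (ball x (max R 0 + 1)) \<le> N"
    using assms unfolding ulf_def by (metis add_nonneg_pos max.cobounded2 zero_less_one)
  obtain r where r: "well_order_on (UNIV::'a set) r" using well_order_on by blast
  have wf: "wf (r - Id)" using r by (simp add: well_order_on_def)
  define P where "P = (\<lambda>(f :: 'a \<Rightarrow> nat) x c. c \<le> N \<and>
    (\<forall>y. (y, x) \<in> r - Id \<longrightarrow> dist x y \<le> R \<longrightarrow> f y \<noteq> c))"
  have "\<exists>col. \<forall>x. P col x (col x)"
  \<comment> \<open>Well-founded recursion applies since \<open>P f x c\<close> reads
    \<open>f\<close> only at points strictly below \<open>x\<close>.\<close>
  proof (rule dependent_wf_choice[OF wf])
    show "P f x c = P g x c" if "\<And>z. (z, x) \<in> r - Id \<Longrightarrow> f z = g z" for f g x c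
      unfolding P_def using that by metis
    show "\<exists>c. P f x c" for x f
    proof -
      let ?B = "ball x (max R 0 + 1)"
      \<comment> \<open>There are \<open>N + 1\<close> colours \<open>0, ..., N\<close>, but at most
        \<open>N\<close> are taken inside the ball.\<close>
      have "card (f ` ?B) < card {..N}"
        using card_image_le[of ?B f] N[of x] by simp
      then have "\<not> {..N} \<subseteq> f ` ?B"
        using card_mono[of "f ` ?B" "{..N}"] N[of x] by (meson finite_imageI not_le)
      then obtain c where c: "c \<le> N" "c \<notin> f ` ?B" by auto
      have "f y \<noteq> c" if "dist x y \<le> R" for y
        using c(2) that by (auto simp: image_iff)
      then show ?thesis using c(1) unfolding P_def by blast
    qed
  qed
  then obtain col where col: "\<And>x. P col x (col x)" by blast
  have "col x \<noteq> col y" if "x \<noteq> y" "dist x y \<le> R" for x y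
  proof -
    \<comment> \<open>Whichever of the two points comes later in the well-order was coloured so as
      to avoid the other.\<close>
    have "(x, y) \<in> r - Id \<or> (y, x) \<in> r - Id"
      using r that(1) unfolding well_order_on_def linear_order_on_def total_on_def by auto
    then show ?thesis using col[of x] col[of y] that(2) unfolding P_def by (metis dist_commute)
  qed
  then show ?thesis using col unfolding P_def by blast
qed

text \<open>If \<open>p\<^sub>c\<close> denotes the projection onto colour \<open>c\<close>, then \<open>\<phi>(b) = \<Sum>\<^sub>c \<phi>(p\<^sub>c p\<^sub>c b) = \<Sum>\<^sub>c \<phi>(p\<^sub>c b p\<^sub>c)\<close>, and \<open>p\<^sub>c b p\<^sub>c\<close> is diagonal.\<close>

lemma KMS_cond_exp_finite_prop:
  fixes b :: "'a::metric_space \<Rightarrow> 'a \<Rightarrow> complex"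
  assumes "ulf TYPE('a)" and K: "is_KMS h \<beta> \<phi>" and b: "b \<in> roe_alg"
  shows "\<phi> b = \<phi> (cond_exp b)"
proof -
  have st: "is_state \<phi>" using K by (simp add: is_KMS_def)
  have bu: "b \<in> uroe" using b roe_alg_subset_uroe by blast
  obtain R where R: "\<And>x y. b x y \<noteq> 0 \<Longrightarrow> dist x y \<le> R"
    using b unfolding roe_alg_def finite_prop_def by blast
  obtain col :: "'a \<Rightarrow> nat" and N where colN: "\<And>x. col x \<le> N"
    and col: "\<And>x y. x \<noteq> y \<Longrightarrow> dist x y \<le> R \<Longrightarrow> col x \<noteq> col y"
    using ulf_colouring[OF assms(1), of R] by blast
  define p :: "nat \<Rightarrow> 'a \<Rightarrow> complex" where "p = (\<lambda>c x. if col x = c then 1 else 0)"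
  have p1: "cmod (p c x) \<le> 1" for c x by (simp add: p_def)
  have pu: "(\<lambda>x y. p c x * a x y) \<in> uroe" if "a \<in> uroe" for a c
    using uroe_mmult[of "\<lambda>x y. if x = y then p c x else 0" a] that
      diag_in_roe_alg[of "p c", OF p1] roe_alg_subset_uroe
    by (auto simp: mmult_diag_left)
  \<comment> \<open>Each point has exactly one colour, so the colour projections sum to the
    identity.\<close>
  have psum: "(\<Sum>c\<le>N. p c x * w) = w" for x w
    using colN[of x] by (simp add: p_def if_distrib[where f="\<lambda>u. u * _"] cong: if_cong)
  have split: "\<phi> a = (\<Sum>c\<le>N. \<phi> (\<lambda>x y. p c x * a x y))" if "a \<in> uroe" for a
    using state_sum[OF st finite_atMost[of N], of "\<lambda>c x y. p c x * a x y"] pu[OF that] by (simp add: psum)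
  have "\<phi> (\<lambda>x y. p c x * b x y) = \<phi> (\<lambda>x y. p c x * cond_exp b x y)" for c
  proof -
    \<comment> \<open>The projection is idempotent; doubling it leaves one copy on the left while
      the KMS condition moves the other to the right.\<close>
    have "\<phi> (\<lambda>x y. p c x * b x y) = \<phi> (\<lambda>x y. p c x * (p c x * b x y))"
      by (rule arg_cong[of _ _ \<phi>]) (auto simp: p_def)
    also have "\<dots> = \<phi> (\<lambda>x y. p c x * b x y * p c y)"
      by (rule KMS_diag_commute[OF K pu[OF bu] p1, symmetric])
    \<comment> \<open>A nonzero off-diagonal entry would join distinct points of the same colour at
      distance at most \<open>R\<close>.\<close>
    also have "(\<lambda>x y. p c x * b x y * p c y) = (\<lambda>x y. p c x * cond_exp b x y)"
      using R col by (force simp: p_def cond_exp_def fun_eq_iff)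
    finally show ?thesis .
  qed
  then show ?thesis
    using split[OF bu] split[OF cond_exp_in_uroe[OF bu]] by simp
qed

section \<open>Passage to the norm closure\<close>

theorem theorem1p5:
  fixes h :: "'a::metric_space \<Rightarrow> real" and \<beta> :: real
    and \<phi> :: "('a \<Rightarrow> 'a \<Rightarrow> complex) \<Rightarrow> complex"
  assumes "ulf TYPE('a)"
    and "coarse_fun h"
    and "is_KMS h \<beta> \<phi>"
  shows "\<forall>a\<in>uroe. \<phi> a = \<phi> (cond_exp a)"
proof
  fix a :: "'a \<Rightarrow> 'a \<Rightarrow> complex" assume a: "a \<in> uroe"
  have st: "is_state \<phi>" using assms(3) by (simp add: is_KMS_def)
  have "cmod (\<phi> a - \<phi> (cond_exp a)) \<le> 0 + e" if e: "0 < e" for e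
  proof -
    \<comment> \<open>\<open>state_bound\<close> costs a factor 4 and is applied to two terms, so
      \<open>e/8\<close> adds up to \<open>e\<close>.\<close>
    have e8: "0 < e/8" using e by simp
    then obtain b where b: "b \<in> roe_alg" "op_bound (e/8) (\<lambda>x y. a x y - b x y)"
      using a unfolding uroe_iff by blast
    have bu: "b \<in> uroe" using b(1) roe_alg_subset_uroe by blast
    let ?c = "\<lambda>x y. a x y - b x y"
    have c: "?c \<in> uroe" by (rule uroe_diff[OF a bu])
    have "cond_exp ?c = (\<lambda>x y. cond_exp a x y - cond_exp b x y)"
      by (simp add: cond_exp_def fun_eq_iff)
    \<comment> \<open>The two functionals agree on \<open>b\<close>, so the defect at
      \<open>a\<close> equals the defect at the small remainder \<open>a - b\<close>.\<close>
    then have "\<phi> ?c - \<phi> (cond_exp ?c) = \<phi> a - \<phi> (cond_exp a)"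
      using KMS_cond_exp_finite_prop[OF assms(1,3) b(1)]
      by (simp add: state_diff[OF st] a bu cond_exp_in_uroe)
    moreover have "cmod (\<phi> ?c) \<le> 4 * (e/8)"
      by (rule state_bound[OF st c b(2) e8])
    moreover have "cmod (\<phi> (cond_exp ?c)) \<le> 4 * (e/8)"
      by (rule state_bound[OF st cond_exp_in_uroe[OF c] op_bound_cond_exp[OF b(2)] e8])
    ultimately show ?thesis
      using norm_triangle_ineq4[of "\<phi> ?c" "\<phi> (cond_exp ?c)"] by simp
  qed
  then have "cmod (\<phi> a - \<phi> (cond_exp a)) \<le> 0" by (rule field_le_epsilon)
  then show "\<phi> a = \<phi> (cond_exp a)" by simp
qed

end
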